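(* Let $A=(a_{ij})\in\mathbb R^{n\times n}$, with diagonal part $A_d$, positive off-diagonal part $A_a^+$ and negative off-diagonal part $A_a^-$. Suppose $A_a^-$ has a decomposition $A_a^-=A^z+A^s$ with $A^s\le 0$ and $A^z\le 0$, and there exists a diagonal matrix $A_{d^*}\ge A_d$ such that: (a) $A_{d^*}+A^z$ is a nonsingular M-matrix; (b) $A_a^+\le A^zA_{d^*}^{-1}A^s$; (c) there exists $\mathbf e\in\mathbb R^n\setminus\{\mathbf 0\}$, $\mathbf e\ge 0$, with $A\mathbf e\ge 0$, such that $A^z$ or $A^s$ connects $\mathcal N^0(A\mathbf e)$ with $\mathcal N^+(A\mathbf e)$. Then $A$ is a product of two nonsingular M-matrices, and thus $A^{-1}\ge 0$.
   Context: All inequalities between matrices or vectors are entrywise. A nonsingular M-matrix is a real square matrix of the form $sI-B$ with $B\ge0$ and $s>\rho(B)$ (equivalently, an invertible matrix with non-positive off-diagonal entries and entrywise nonnegative inverse). For $A=(a_{ij})\in\mathbb R^{n\times n}$: $A_d$ is the diagonal matrix with the same diagonal as $A$; $A_a=A-A_d$; $A_a^+$ has entries $(A_a^+)_{ij}=a_{ij}$ if $i\ne j$ and $a_{ij}>0$, and $0$ otherwise; $A_a^-=A_a-A_a^+$. For a vector $\mathbf x$, $\mathcal N^0(A\mathbf x)=\{i:(A\mathbf x)_i=0\}$ and $\mathcal N^+(A\mathbf x)=\{i:(A\mathbf x)_i>0\}$. Let $\mathcal N=\{1,\dots,n\}$ and $\mathcal N_1,\mathcal N_2\subset\mathcal N$.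 A matrix $B=(b_{ij})\in\mathbb R^{n\times n}$ connects $\mathcal N_1$ with $\mathcal N_2$ if for every $i_0\in\mathcal N_1$ there exist $i_r\in\mathcal N_2$ and $i_1,\dots,i_{r-1}\in\mathcal N$ such that $b_{i_{k-1}i_k}\ne0$ for $k=1,\dots,r$ (i.e., in the directed graph of $B$ there is a directed path from each vertex of $\mathcal N_1$ to some vertex of $\mathcal N_2$). In particular, if $\mathcal N_1=\emptyset$ then any matrix connects $\mathcal N_1$ with $\mathcal N_2$. *)

theory Defs
  imports "Jordan_Normal_Form.Spectral_Radius" "Jordan_Normal_Form.Gauss_Jordan_Elimination"
begin

text \<open>The order \<open>\<le>\<close> of Jordan_Normal_Form on matrices and on vectors is the entrywise one
  (and includes equality of dimensions); indices run over \<open>{0..<n}\<close>.\<close>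

definition nonsingular_M_matrix :: "real mat \<Rightarrow> bool" where
  "nonsingular_M_matrix A \<longleftrightarrow>
     (\<exists>n s B. B \<in> carrier_mat n n \<and> 0\<^sub>m n n \<le> B \<and>
        spectral_radius (map_mat complex_of_real B) < s \<and> A = s \<cdot>\<^sub>m 1\<^sub>m n - B)"

definition diag_part :: "real mat \<Rightarrow> real mat" where
  "diag_part A = Matrix.mat (dim_row A) (dim_col A) (\<lambda>(i, j). if i = j then A $$ (i, j) else 0)"

definition offdiag_part :: "real mat \<Rightarrow> real mat" where
  "offdiag_part A = A - diag_part A"

definition offdiag_pos_part :: "real mat \<Rightarrow> real mat" where
  "offdiag_pos_part A = Matrix.mat (dim_row A) (dim_col A)
     (\<lambda>(i, j). if i \<noteq> j \<and> A $$ (i, j) > 0 then A $$ (i, j) else 0)"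

text \<open>The sign is kept: this matrix is entrywise nonpositive.\<close>

definition offdiag_neg_part :: "real mat \<Rightarrow> real mat" where
  "offdiag_neg_part A = offdiag_part A - offdiag_pos_part A"

definition zero_indices :: "real Matrix.vec \<Rightarrow> nat set" where
  "zero_indices v = {i. i < dim_vec v \<and> v $ i = 0}"

definition pos_indices :: "real Matrix.vec \<Rightarrow> nat set" where
  "pos_indices v = {i. i < dim_vec v \<and> v $ i > 0}"

text \<open>The sequence \<open>p 0, \<dots>, p r\<close> is the path; it has at least one edge, so a vertex of
  \<open>N\<^sub>1 \<inter> N\<^sub>2\<close> is not regarded as connected to itself by an empty path.\<close>

definition connects :: "real mat \<Rightarrow> nat set \<Rightarrow> nat set \<Rightarrow> bool" where
  "connects B N\<^sub>1 N\<^sub>2 \<longleftrightarrow>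
     (\<forall>i\<in>N\<^sub>1. \<exists>r\<ge>1. \<exists>p :: nat \<Rightarrow> nat.
        p 0 = i \<and> p r \<in> N\<^sub>2 \<and> (\<forall>k\<in>{1..<r}. p k < dim_row B) \<and>
        (\<forall>k\<in>{1..r}. B $$ (p (k - 1), p k) \<noteq> 0))"

text \<open>Meaningful for invertible matrices only, since \<^const>\<open>mat_inverse\<close> returns \<^const>\<open>None\<close>
  on all others.\<close>

definition mat_inv :: "real mat \<Rightarrow> real mat" where
  "mat_inv A = the (mat_inverse A)"

end

theory Submission
  imports Defs
begin

text \<open>
  Put \<open>M = A\<^sub>d\<^sub>* + A\<^sup>z\<close> and \<open>N = I + A\<^sub>d\<^sub>*\<^sup>-\<^sup>1 A\<^sup>s\<close>. Multiplying out gives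
  \<open>M N = A\<^sub>d\<^sub>* + A\<^sup>z + A\<^sup>s + A\<^sup>z A\<^sub>d\<^sub>*\<^sup>-\<^sup>1 A\<^sup>s\<close>, and the hypotheses on the diagonal and on the positive
  part of \<open>A\<close> say that this dominates \<open>A\<close>. Since \<open>M\<^sup>-\<^sup>1 \<ge> 0\<close>, the quotient
  \<open>C = M\<^sup>-\<^sup>1 A\<close> satisfies \<open>C \<le> N\<close>. Hence its off-diagonal entries are nonpositive, and they are
  nonzero wherever those of \<open>A\<^sup>s\<close> are. As \<open>A = M C\<close>, it remains to see that \<open>C\<close> is a nonsingular
  M-matrix.

  The vector \<open>e\<close> is the witness. Here \<open>y = C e = M\<^sup>-\<^sup>1 (A e)\<close> is nonnegative, and it is positive
  wherever \<open>A e\<close> is. If \<open>A\<^sup>z\<close> provides the connecting paths, positivity of \<open>M y = A e\<close> travels back along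
  edges of \<open>M\<close> and makes all of \<open>y\<close> positive (\<open>positive_of_connects\<close>). If \<open>A\<^sup>s\<close> provides them,
  they are paths in the graph of \<open>C\<close> from the zeros of \<open>C e\<close> to its positive entries. Both
  situations are covered by one criterion (\<open>nonsingular_M_matrix_of_connects\<close>): a matrix with
  nonpositive off-diagonal entries and a nonnegative vector of nonnegative image, whose zeros are
  connected to its positive entries, is a nonsingular M-matrix.

  The two analytic ingredients relate the spectral radius to signs. In one direction, bounded
  powers of a scaled \<open>B\<close> show that \<open>s I - B\<close> is inverse-nonnegative; in the other, a complex
  eigenvector of \<open>B\<close> is compared with the positive vector \<open>e\<close> by a maximum principle.
\<close>

section \<open>Products and signs\<close>

lemma mult_mat_vec_index_sum:
  assumes "A \<in> carrier_mat m n" "x \<in> carrier_vec n" "i < m"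
  shows "(A *\<^sub>v x) $ i = (\<Sum>j = 0..<n. A $$ (i, j) * x $ j)"
  using assms by (auto simp: scalar_prod_def intro!: sum.cong)

lemma smult_mat_mult_vec:
  fixes A :: "'a :: comm_semiring_0 mat"
  assumes "A \<in> carrier_mat m n" "x \<in> carrier_vec n"
  shows "(a \<cdot>\<^sub>m A) *\<^sub>v x = a \<cdot>\<^sub>v (A *\<^sub>v x)"
  using assms by (intro eq_vecI) (auto simp: scalar_prod_def sum_distrib_left mult.assoc intro!: sum.cong)

lemma mult_mat_index_sum:
  assumes "A \<in> carrier_mat m n" "B \<in> carrier_mat n k" "i < m" "j < k"
  shows "(A * B) $$ (i, j) = (\<Sum>l = 0..<n. A $$ (i, l) * B $$ (l, j))"
  using assms by (auto simp: scalar_prod_def intro!: sum.cong)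

lemma mult_mat_nonneg:
  fixes A B :: "real mat"
  assumes "A \<in> carrier_mat n n" "B \<in> carrier_mat n n" "0\<^sub>m n n \<le> A" "0\<^sub>m n n \<le> B"
  shows "0\<^sub>m n n \<le> A * B"
  using assms mult_mat_index_sum[OF assms(1,2)]
  by (auto simp: less_eq_mat_def intro!: sum_nonneg)

lemma mult_mat_vec_nonneg:
  fixes A :: "real mat"
  assumes "A \<in> carrier_mat n n" "x \<in> carrier_vec n" "0\<^sub>m n n \<le> A" "0\<^sub>v n \<le> x"
  shows "0\<^sub>v n \<le> A *\<^sub>v x"
proof -
  have "0 \<le> (A *\<^sub>v x) $ i" if "i < n" for i
    unfolding mult_mat_vec_index_sum[OF assms(1,2) that]
    using assms that by (intro sum_nonneg) (auto simp: less_eq_vec_def less_eq_mat_def)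
  then show ?thesis using assms(1) by (simp add: less_eq_vec_def del: index_mult_mat_vec)
qed

section \<open>Monotonicity of nonsingular M-matrices\<close>

text \<open>Scaling makes the spectral radius smaller than \<open>1\<close>, so that the Jordan normal form of the
  complexified matrix yields the bound.\<close>

lemma bounded_powers_of_small_spectral_radius:
  fixes B :: "real mat"
  assumes B: "B \<in> carrier_mat n n" and n: "n > 0" and t: "t > 0"
    and sr: "spectral_radius (map_mat complex_of_real B) < t"
  shows "\<exists>c. \<forall>k. norm_bound (((1 / t) \<cdot>\<^sub>m B) ^\<^sub>m k) c"
proof -
  let ?K = "(1 / t) \<cdot>\<^sub>m B"
  let ?C = "map_mat complex_of_real"
  have K: "?K \<in> carrier_mat n n" and CK: "?C ?K \<in> carrier_mat n n"
    and CB: "?C B \<in> carrier_mat n n" using B by auto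
  have "spectral_radius (?C ?K) < 1"
  proof -
    obtain l where l: "l \<in> spectrum (?C ?K)" "norm l = spectral_radius (?C ?K)"
      using spectral_radius_mem_max(1)[OF CK n] by auto
    then obtain v where v: "v \<in> carrier_vec n" "v \<noteq> 0\<^sub>v n" "?C ?K *\<^sub>v v = l \<cdot>\<^sub>v v"
      using B unfolding spectrum_def eigenvalue_def eigenvector_def by auto
    have "?C B = complex_of_real t \<cdot>\<^sub>m ?C ?K"
      by (rule eq_matI) (use t in auto)
    then have "?C B *\<^sub>v v = complex_of_real t \<cdot>\<^sub>v (l \<cdot>\<^sub>v v)"
      using v CK by (metis smult_mat_mult_vec)
    then have "?C B *\<^sub>v v = (complex_of_real t * l) \<cdot>\<^sub>v v"
      by (simp add: smult_smult_assoc)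
    then have "complex_of_real t * l \<in> spectrum (?C B)"
      using v B unfolding spectrum_def eigenvalue_def eigenvector_def by auto
    then have "norm (complex_of_real t * l) \<le> spectral_radius (?C B)"
      using spectral_radius_mem_max(2)[OF CB n] by blast
    then have "t * norm l \<le> spectral_radius (?C B)" using t by (simp add: norm_mult)
    then have "t * norm l < t" using sr by linarith
    then have "norm l < 1" using t mult_less_cancel_left_pos[of t "norm l" 1] by simp
    then show ?thesis using l(2) by simp
  qed
  then obtain c where c: "\<And>k. norm_bound (?C ?K ^\<^sub>m k) c"
    using spectral_radius_jnf_norm_bound_less_1_upper_triangular[OF CK] by blast
  have "norm_bound (?K ^\<^sub>m k) c" for k
  proof
    fix i j assume ij: "i < dim_row (?K ^\<^sub>m k)" "j < dim_col (?K ^\<^sub>m k)"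
    have "?C ?K ^\<^sub>m k = ?C (?K ^\<^sub>m k)" using of_real_hom.mat_hom_pow[OF K] by metis
    then show "norm ((?K ^\<^sub>m k) $$ (i, j)) \<le> c"
      using c[of k] ij unfolding norm_bound_def by (auto simp del: pow_mat_dim)
  qed
  then show ?thesis by blast
qed

text \<open>If \<open>(s I - B) x \<ge> 0\<close> then \<open>x \<ge> s\<^sup>-\<^sup>1 B x\<close>. Because \<open>B \<ge> 0\<close> this can be iterated to
  \<open>x \<ge> s\<^sup>-\<^sup>k B\<^sup>k x\<close>, whose right-hand side tends to \<open>0\<close>. Both the invertibility of an M-matrix and
  the sign of its inverse follow from this implication.\<close>

lemma nonsingular_M_matrix_monotone:
  fixes M :: "real mat"
  assumes M: "nonsingular_M_matrix M" "M \<in> carrier_mat n n"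
    and x: "x \<in> carrier_vec n" and Mx: "0\<^sub>v n \<le> M *\<^sub>v x"
  shows "0\<^sub>v n \<le> x"
proof (cases "n = 0")
  case True
  then show ?thesis using x by (auto simp: less_eq_vec_def)
next
  case False
  then have n: "n > 0" by simp
  obtain s B where B: "B \<in> carrier_mat n n" "0\<^sub>m n n \<le> B"
    and sr: "spectral_radius (map_mat complex_of_real B) < s" and MB: "M = s \<cdot>\<^sub>m 1\<^sub>m n - B"
    using M unfolding nonsingular_M_matrix_def by auto
  let ?C = "map_mat complex_of_real B"
  have "0 \<le> spectral_radius ?C"
    using spectral_radius_mem_max(1)[of ?C n] B n by auto
  \<comment> \<open>The powers of \<open>K = B / t\<close> are only bounded; the gap between \<open>t\<close> and \<open>s\<close> supplies the
     decaying factor \<open>q\<^sup>k\<close>, with \<open>B / s = q K\<close>.\<close>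
  then obtain t where t: "t > 0" "t < s" "spectral_radius ?C < t"
    using sr by (meson dense order_le_less_trans)
  define q where "q = t / s"
  have q: "0 < q" "q < 1" using t by (auto simp: q_def)
  define K where "K = (1 / t) \<cdot>\<^sub>m B"
  have K: "K \<in> carrier_mat n n" "0\<^sub>m n n \<le> K"
    using B t by (auto simp: K_def less_eq_mat_def)
  have Kk: "K ^\<^sub>m k \<in> carrier_mat n n" "0\<^sub>m n n \<le> K ^\<^sub>m k" for k
  proof -
    show "K ^\<^sub>m k \<in> carrier_mat n n" using K by simp
    show "0\<^sub>m n n \<le> K ^\<^sub>m k"
    proof (induction k)
      case 0
      then show ?case using K by (auto simp: less_eq_mat_def)
    next
      case (Suc k)
      then show ?case using K mult_mat_nonneg[of "K ^\<^sub>m k" n K] by simp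
    qed
  qed
  obtain c where c: "\<And>k. norm_bound (K ^\<^sub>m k) c"
    using bounded_powers_of_small_spectral_radius[OF B(1) n t(1) t(3)] unfolding K_def by blast
  have step: "q * (K *\<^sub>v x) $ i \<le> x $ i" if i: "i < n" for i
  proof -
    have "(M *\<^sub>v x) $ i = s * x $ i - (B *\<^sub>v x) $ i"
    proof -
      have "M *\<^sub>v x = s \<cdot>\<^sub>v x - B *\<^sub>v x"
        unfolding MB using B x
        by (subst minus_mult_distrib_mat_vec[of _ n n]) (auto simp: smult_mat_mult_vec)
      then show ?thesis using i x B by (simp del: index_mult_mat_vec)
    qed
    moreover have "0 \<le> (M *\<^sub>v x) $ i" using Mx i by (auto simp: less_eq_vec_def)
    moreover have "(B *\<^sub>v x) $ i = t * (K *\<^sub>v x) $ i"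
    proof -
      have "K *\<^sub>v x = (1 / t) \<cdot>\<^sub>v (B *\<^sub>v x)"
        unfolding K_def using B x by (simp add: smult_mat_mult_vec)
      then show ?thesis using i x B t by (simp del: index_mult_mat_vec)
    qed
    ultimately show ?thesis using t by (simp add: q_def field_simps)
  qed
  have iter: "q ^ k * (K ^\<^sub>m k *\<^sub>v x) $ i \<le> x $ i" if "i < n" for k i
    using that
  proof (induction k arbitrary: i)
    case 0
    then show ?case using x K by simp
  next
    case (Suc k)
    note i = \<open>i < n\<close>
    have Kx: "K *\<^sub>v x \<in> carrier_vec n" using K x by auto
    have "K ^\<^sub>m Suc k *\<^sub>v x = K ^\<^sub>m k *\<^sub>v (K *\<^sub>v x)"
      using K x by (simp add: assoc_mult_mat_vec[OF Kk(1)])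
    then have "q * (K ^\<^sub>m Suc k *\<^sub>v x) $ i
        = (\<Sum>j = 0..<n. (K ^\<^sub>m k) $$ (i, j) * (q * (K *\<^sub>v x) $ j))"
      using mult_mat_vec_index_sum[OF Kk(1) Kx i, of k]
      by (simp add: sum_distrib_left mult_ac)
    also have "\<dots> \<le> (\<Sum>j = 0..<n. (K ^\<^sub>m k) $$ (i, j) * x $ j)"
      using Kk[of k] i step
      by (intro sum_mono mult_left_mono) (auto simp: less_eq_mat_def)
    also have "\<dots> = (K ^\<^sub>m k *\<^sub>v x) $ i"
      using mult_mat_vec_index_sum[OF Kk(1) x i] by simp
    finally have "q ^ k * (q * (K ^\<^sub>m Suc k *\<^sub>v x) $ i) \<le> q ^ k * (K ^\<^sub>m k *\<^sub>v x) $ i"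
      using q by (intro mult_left_mono) auto
    also have "\<dots> \<le> x $ i" using Suc by auto
    finally show ?case by (simp only: power_Suc mult_ac)
  qed
  have "0 \<le> x $ i" if i: "i < n" for i
  proof -
    define S where "S = (\<Sum>j = 0..<n. c * \<bar>x $ j\<bar>)"
    have low: "q ^ k * (- S) \<le> x $ i" for k
    proof -
      have "\<bar>(K ^\<^sub>m k *\<^sub>v x) $ i\<bar> \<le> (\<Sum>j = 0..<n. \<bar>(K ^\<^sub>m k) $$ (i, j) * x $ j\<bar>)"
        unfolding mult_mat_vec_index_sum[OF Kk(1) x i] by (rule sum_abs)
      also have "\<dots> \<le> S"
        unfolding S_def abs_mult using c[of k] i Kk(1)[of k]
        by (intro sum_mono mult_right_mono) (auto simp: norm_bound_def simp del: pow_mat_dim)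
      finally have "q ^ k * (- S) \<le> q ^ k * (K ^\<^sub>m k *\<^sub>v x) $ i"
        using q by (intro mult_left_mono) auto
      then show ?thesis using iter[OF i, of k] by linarith
    qed
    have "(\<lambda>k. q ^ k * (- S)) \<longlonglongrightarrow> 0 * (- S)"
      using q by (intro tendsto_intros LIMSEQ_power_zero) auto
    then have "0 * (- S) \<le> x $ i"
      by (rule LIMSEQ_le_const2) (use low in auto)
    then show ?thesis by simp
  qed
  then show ?thesis using x by (auto simp: less_eq_vec_def)
qed

text \<open>Monotonicity applied to \<open>v\<close> and \<open>- v\<close> makes the kernel trivial; applied to the columns of
  the inverse, whose images are unit vectors, it makes the inverse nonnegative.\<close>

lemma nonsingular_M_matrix_nonneg_inverse:
  fixes M :: "real mat"
  assumes M: "nonsingular_M_matrix M" "M \<in> carrier_mat n n"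
  obtains P where "P \<in> carrier_mat n n" "0\<^sub>m n n \<le> P" "M * P = 1\<^sub>m n" "P * M = 1\<^sub>m n"
proof -
  have "det M \<noteq> 0"
  proof
    assume "det M = 0"
    then obtain v where v: "v \<in> carrier_vec n" "v \<noteq> 0\<^sub>v n" "M *\<^sub>v v = 0\<^sub>v n"
      using det_0_iff_vec_prod_zero[OF M(2)] by blast
    have "0\<^sub>v n \<le> v" using nonsingular_M_matrix_monotone[OF M v(1)] v(3) by simp
    moreover have "M *\<^sub>v ((- 1) \<cdot>\<^sub>v v) = 0\<^sub>v n"
      using v(3) mult_mat_vec[OF M(2) v(1), of "- 1"] by (intro eq_vecI) auto
    then have "0\<^sub>v n \<le> (- 1) \<cdot>\<^sub>v v"
      using nonsingular_M_matrix_monotone[OF M, of "(- 1) \<cdot>\<^sub>v v"] v(1) by simp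
    ultimately have "v = 0\<^sub>v n" using v(1)
      by (intro eq_vecI) (auto simp: less_eq_vec_def intro!: antisym)
    then show False using v(2) by simp
  qed
  then have "M \<in> Units (ring_mat TYPE(real) n ())" by (rule det_non_zero_imp_unit[OF M(2)])
  then obtain P where P: "P \<in> carrier_mat n n" "M * P = 1\<^sub>m n" "P * M = 1\<^sub>m n"
    using M by (auto simp: Units_def ring_mat_def)
  have "0\<^sub>v n \<le> col P j" if j: "j < n" for j
  proof -
    have "M *\<^sub>v col P j = unit_vec n j" using P j M by (metis col_mult2 col_one)
    then have "0\<^sub>v n \<le> M *\<^sub>v col P j" using j by (auto simp: less_eq_vec_def unit_vec_def)
    then show ?thesis using nonsingular_M_matrix_monotone[OF M, of "col P j"] P j by auto
  qed
  then have "0\<^sub>m n n \<le> P" using P(1) by (auto simp: less_eq_mat_def less_eq_vec_def)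
  then show ?thesis using P that by blast
qed

lemma nonsingular_M_matrix_offdiag_nonpos:
  assumes "nonsingular_M_matrix M" "M \<in> carrier_mat n n" "i < n" "j < n" "i \<noteq> j"
  shows "M $$ (i, j) \<le> 0"
proof -
  obtain s B where B: "B \<in> carrier_mat n n" "0\<^sub>m n n \<le> B" "M = s \<cdot>\<^sub>m 1\<^sub>m n - B"
    using assms(1,2) unfolding nonsingular_M_matrix_def by auto
  have "0 \<le> B $$ (i, j)" using B assms(3,4) by (auto simp: less_eq_mat_def)
  then show ?thesis using B assms(3-5) by simp
qed

text \<open>In the \<open>i\<close>-th diagonal entry \<open>1\<close> of \<open>M M\<^sup>-\<^sup>1\<close>, every summand except the diagonal one is
  nonpositive.\<close>

lemma nonsingular_M_matrix_diag_pos: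
  fixes M :: "real mat"
  assumes M: "nonsingular_M_matrix M" "M \<in> carrier_mat n n" and i: "i < n"
  shows "M $$ (i, i) > 0"
proof -
  obtain P where P: "P \<in> carrier_mat n n" "0\<^sub>m n n \<le> P" "M * P = 1\<^sub>m n"
    using nonsingular_M_matrix_nonneg_inverse[OF M] by blast
  have P0: "0 \<le> P $$ (j, k)" if "j < n" "k < n" for j k
    using P that by (auto simp: less_eq_mat_def)
  have "1 = (\<Sum>l = 0..<n. M $$ (i, l) * P $$ (l, i))"
    using mult_mat_index_sum[OF M(2) P(1) i i] P(3) i by simp
  also have "\<dots> = M $$ (i, i) * P $$ (i, i) + (\<Sum>l \<in> {0..<n} - {i}. M $$ (i, l) * P $$ (l, i))"
    using i by (subst sum.remove[of _ i]) auto
  also have "(\<Sum>l \<in> {0..<n} - {i}. M $$ (i, l) * P $$ (l, i)) \<le> 0"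
    using i P0 nonsingular_M_matrix_offdiag_nonpos[OF M i]
    by (intro sum_nonpos) (auto simp: mult_nonpos_nonneg)
  finally have "M $$ (i, i) * P $$ (i, i) > 0" by simp
  then show ?thesis using P0[OF i i] by (simp add: zero_less_mult_iff)
qed

section \<open>Connectedness and M-matrices\<close>

text \<open>All uses of connectedness have this form: a set of bad indices that is closed under the edges
  of \<open>B\<close>, and avoids the target, cannot contain a source.\<close>

lemma connects_closed_set_meets_target:
  assumes con: "connects B N1 N2" and i: "i \<in> N1" "i \<in> S"
    and B: "B \<in> carrier_mat n n" and N2: "N2 \<subseteq> {..<n}"
    and step: "\<And>j k. j \<in> S \<Longrightarrow> k < n \<Longrightarrow> B $$ (j, k) \<noteq> 0 \<Longrightarrow> k \<in> S"
  shows "\<exists>j \<in> N2. j \<in> S"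
proof -
  obtain r :: nat and p where p0: "p 0 = i" and pr: "p r \<in> N2"
    and inner: "\<forall>k\<in>{1..<r}. p k < dim_row B"
    and edges: "\<forall>k\<in>{1..r}. B $$ (p (k - 1), p k) \<noteq> 0"
    by (rule bspec[OF con[unfolded connects_def] i(1), THEN exE], elim conjE exE, rule that)
  have "p k \<in> S" if "k \<le> r" for k
    using that
  proof (induction k)
    case 0
    then show ?case using p0 i(2) by simp
  next
    case (Suc k)
    have "p (Suc k) < n"
      using Suc(2) inner pr N2 B by (cases "Suc k = r") auto
    moreover have "B $$ (p k, p (Suc k)) \<noteq> 0"
      using edges[rule_format, of "Suc k"] Suc(2) by simp
    ultimately show ?case using step Suc by auto
  qed
  then show ?thesis using pr by blast
qed

text \<open>If \<open>v\<^sub>i = 0\<close>, then \<open>(C v)\<^sub>i\<close> is a sum of nonpositive terms \<open>c\<^sub>i\<^sub>k v\<^sub>k\<close>. Being nonnegative,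
  it vanishes, and so does \<open>v\<^sub>k\<close> for every neighbour \<open>k\<close> of \<open>i\<close>. The zeros of \<open>v\<close> thus form a
  closed set on which \<open>C v\<close> is zero. The paths are taken in a matrix \<open>B\<close> whose off-diagonal edges
  are edges of \<open>C\<close>: loops do not matter, and the theorem needs \<open>B = A\<^sup>z\<close> and \<open>B = A\<^sup>s\<close>.\<close>

lemma positive_of_connects:
  fixes C :: "real mat"
  assumes C: "C \<in> carrier_mat n n" and B: "B \<in> carrier_mat n n"
    and Z: "\<And>i j. i < n \<Longrightarrow> j < n \<Longrightarrow> i \<noteq> j \<Longrightarrow> C $$ (i, j) \<le> 0"
    and sub: "\<And>i j. i < n \<Longrightarrow> j < n \<Longrightarrow> i \<noteq> j \<Longrightarrow> B $$ (i, j) \<noteq> 0 \<Longrightarrow> C $$ (i, j) \<noteq> 0"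
    and v: "v \<in> carrier_vec n" "0\<^sub>v n \<le> v" and Cv: "0\<^sub>v n \<le> C *\<^sub>v v"
    and con: "connects B (zero_indices (C *\<^sub>v v)) (pos_indices (C *\<^sub>v v))"
    and i: "i < n"
  shows "v $ i > 0"
proof (rule ccontr)
  have v0: "0 \<le> v $ j" if "j < n" for j using v that by (auto simp: less_eq_vec_def)
  have Cv0: "0 \<le> (C *\<^sub>v v) $ j" if "j < n" for j
    using Cv that by (auto simp: less_eq_vec_def simp del: index_mult_mat_vec)
  define S where "S = {j. j < n \<and> v $ j = 0}"
  assume "\<not> v $ i > 0"
  then have iS: "i \<in> S" using v0[OF i] i by (auto simp: S_def)
  have terms: "C $$ (j, k) * v $ k \<le> 0" if "j \<in> S" "k < n" for j k
    using that Z v0 by (cases "j = k") (auto simp: S_def mult_nonpos_nonneg)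
  have sumz: "(C *\<^sub>v v) $ j = 0 \<and> (\<forall>k<n. C $$ (j, k) * v $ k = 0)" if j: "j \<in> S" for j
  proof -
    have jn: "j < n" using j by (simp add: S_def)
    note eq = mult_mat_vec_index_sum[OF C v(1) jn]
    have le: "(\<Sum>k = 0..<n. C $$ (j, k) * v $ k) \<le> 0"
      using terms[OF j] by (intro sum_nonpos) auto
    have z: "(C *\<^sub>v v) $ j = 0" using le eq Cv0[OF jn] by linarith
    have "\<forall>k\<in>{0..<n}. - (C $$ (j, k) * v $ k) = 0"
      using z eq terms[OF j] by (subst sum_nonneg_eq_0_iff[symmetric]) (auto simp: sum_negf)
    then show ?thesis using z by auto
  qed
  have "i \<in> zero_indices (C *\<^sub>v v)"
    using sumz[OF iS] i C by (auto simp: zero_indices_def simp del: index_mult_mat_vec)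
  then have "\<exists>j \<in> pos_indices (C *\<^sub>v v). j \<in> S"
  proof (rule connects_closed_set_meets_target[OF con _ iS B])
    show "pos_indices (C *\<^sub>v v) \<subseteq> {..<n}" using C by (auto simp: pos_indices_def)
    fix j k assume j: "j \<in> S" and k: "k < n" and "B $$ (j, k) \<noteq> 0"
    then show "k \<in> S"
      using sumz[OF j] sub[of j k] by (cases "j = k") (auto simp: S_def)
  qed
  then show False using sumz by (auto simp: pos_indices_def simp del: index_mult_mat_vec)
qed

text \<open>By \<open>positive_of_connects\<close> the vector \<open>v\<close> is positive. Write \<open>C = s I - T\<close> with
  \<open>T \<ge> 0\<close>; then \<open>T v \<le> s v\<close>. For an eigenvector \<open>x\<close> of \<open>T\<close> with eigenvalue \<open>l\<close>, consider the ratios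
  \<open>u\<^sub>j = \<bar>x\<^sub>j\<bar> / v\<^sub>j\<close> and their maximum \<open>m\<close>. At an index \<open>i\<close> attaining it,
  \<open>\<bar>l\<bar> m v\<^sub>i \<le> \<Sum>\<^sub>j t\<^sub>i\<^sub>j u\<^sub>j v\<^sub>j \<le> m (T v)\<^sub>i \<le> s m v\<^sub>i\<close>. If \<open>\<bar>l\<bar> \<ge> s\<close>, equality holds throughout,
  so \<open>(C v)\<^sub>i = 0\<close> and all neighbours of \<open>i\<close> attain the maximum too. The maximizers then form a
  closed set on which \<open>C v\<close> is zero, contrary to connectedness. Hence \<open>\<bar>l\<bar> < s\<close>.\<close>

lemma nonsingular_M_matrix_of_connects:
  fixes C :: "real mat"
  assumes C: "C \<in> carrier_mat n n" and B: "B \<in> carrier_mat n n"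
    and Z: "\<And>i j. i < n \<Longrightarrow> j < n \<Longrightarrow> i \<noteq> j \<Longrightarrow> C $$ (i, j) \<le> 0"
    and sub: "\<And>i j. i < n \<Longrightarrow> j < n \<Longrightarrow> i \<noteq> j \<Longrightarrow> B $$ (i, j) \<noteq> 0 \<Longrightarrow> C $$ (i, j) \<noteq> 0"
    and v: "v \<in> carrier_vec n" "0\<^sub>v n \<le> v" and Cv: "0\<^sub>v n \<le> C *\<^sub>v v"
    and con: "connects B (zero_indices (C *\<^sub>v v)) (pos_indices (C *\<^sub>v v))"
    and n: "n > 0"
  shows "nonsingular_M_matrix C"
proof -
  have pos: "v $ i > 0" if "i < n" for i
    by (rule positive_of_connects[OF C B Z sub v Cv con that])
  have Cv0: "0 \<le> (C *\<^sub>v v) $ j" if "j < n" for j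
    using Cv that by (auto simp: less_eq_vec_def simp del: index_mult_mat_vec)
  \<comment> \<open>The least \<open>s\<close> for which \<open>T\<close> is nonnegative.\<close>
  define s where "s = Max ((\<lambda>i. C $$ (i, i)) ` {0..<n})"
  have s: "C $$ (i, i) \<le> s" if "i < n" for i
    unfolding s_def using that by (intro Max_ge) auto
  define T where "T = s \<cdot>\<^sub>m 1\<^sub>m n - C"
  have T: "T \<in> carrier_mat n n" using C by (auto simp: T_def)
  have T0: "0 \<le> T $$ (i, j)" if "i < n" "j < n" for i j
    using that C s Z by (auto simp: T_def)
  have CT: "C = s \<cdot>\<^sub>m 1\<^sub>m n - T" using C by (auto simp: T_def)
  have Tv: "(T *\<^sub>v v) $ i = s * v $ i - (C *\<^sub>v v) $ i" if i: "i < n" for i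
  proof -
    have "T *\<^sub>v v = s \<cdot>\<^sub>v v - C *\<^sub>v v"
      unfolding T_def using C v
      by (subst minus_mult_distrib_mat_vec[of _ n n]) (auto simp: smult_mat_mult_vec)
    then show ?thesis using i C v by (simp del: index_mult_mat_vec)
  qed
  let ?T = "map_mat complex_of_real T"
  have cT: "?T \<in> carrier_mat n n" using T by simp
  have "norm l < s" if "l \<in> spectrum ?T" for l
  proof (rule ccontr)
    assume "\<not> norm l < s"
    then have ls: "s \<le> norm l" by simp
    obtain x where x: "x \<in> carrier_vec n" "x \<noteq> 0\<^sub>v n" "?T *\<^sub>v x = l \<cdot>\<^sub>v x"
      using \<open>l \<in> spectrum ?T\<close> T unfolding spectrum_def eigenvalue_def eigenvector_def by auto
    define u where "u j = norm (x $ j) / v $ j" for j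
    define m where "m = Max (u ` {0..<n})"
    have um: "u j \<le> m" if "j < n" for j unfolding m_def using that by (intro Max_ge) auto
    have xu: "norm (x $ j) = u j * v $ j" if "j < n" for j
      using pos[OF that] by (simp add: u_def)
    have "m > 0"
    proof -
      have "\<exists>j<n. x $ j \<noteq> 0"
      proof (rule ccontr)
        assume "\<not> (\<exists>j<n. x $ j \<noteq> 0)"
        then have "x = 0\<^sub>v n" using x(1) by (intro eq_vecI) auto
        then show False using x(2) by simp
      qed
      then obtain j where j: "j < n" "x $ j \<noteq> 0" by blast
      then have "u j > 0" using pos[OF j(1)] by (simp add: u_def)
      then show ?thesis using um[OF j(1)] by linarith
    qed
    define S where "S = {j. j < n \<and> u j = m}"
    have "m \<in> u ` {0..<n}" unfolding m_def using n by (intro Max_in) auto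
    then obtain i0 where i0: "i0 \<in> S" by (auto simp: S_def)
    have extremal: "(C *\<^sub>v v) $ i = 0 \<and> (\<forall>j<n. T $$ (i, j) * (m - u j) = 0)" if i: "i \<in> S" for i
    proof -
      have iN: "i < n" and ui: "u i = m" using i by (auto simp: S_def)
      have nn: "0 \<le> T $$ (i, j) * ((m - u j) * v $ j)" if "j < n" for j
        using T0[OF iN that] um[OF that] pos[OF that] by simp
      have "l * x $ i = (\<Sum>j = 0..<n. complex_of_real (T $$ (i, j)) * x $ j)"
        using mult_mat_vec_index_sum[OF cT x(1) iN] x iN T by simp
      then have "norm (l * x $ i) \<le> (\<Sum>j = 0..<n. norm (complex_of_real (T $$ (i, j)) * x $ j))"
        by (metis norm_sum)
      also have "\<dots> = (\<Sum>j = 0..<n. T $$ (i, j) * (u j * v $ j))"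
        using T0[OF iN] xu by (intro sum.cong) (auto simp: norm_mult)
      also have "\<dots> = (\<Sum>j = 0..<n. m * (T $$ (i, j) * v $ j) - T $$ (i, j) * ((m - u j) * v $ j))"
        by (intro sum.cong) (auto simp: algebra_simps)
      also have "\<dots> = m * (T *\<^sub>v v) $ i - (\<Sum>j = 0..<n. T $$ (i, j) * ((m - u j) * v $ j))"
        unfolding mult_mat_vec_index_sum[OF T v(1) iN] by (simp add: sum_subtractf sum_distrib_left)
      finally have "norm l * (m * v $ i) \<le> m * s * v $ i - m * (C *\<^sub>v v) $ i
          - (\<Sum>j = 0..<n. T $$ (i, j) * ((m - u j) * v $ j))"
        using xu[OF iN] ui Tv[OF iN] by (simp add: norm_mult algebra_simps)
      moreover have "s * (m * v $ i) \<le> norm l * (m * v $ i)"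
        using ls \<open>m > 0\<close> pos[OF iN] by (intro mult_right_mono) auto
      ultimately have sum0: "m * (C *\<^sub>v v) $ i + (\<Sum>j = 0..<n. T $$ (i, j) * ((m - u j) * v $ j)) \<le> 0"
        by (simp add: algebra_simps)
      have s0: "0 \<le> (\<Sum>j = 0..<n. T $$ (i, j) * ((m - u j) * v $ j))"
        using nn by (intro sum_nonneg) auto
      have m0: "0 \<le> m * (C *\<^sub>v v) $ i" using \<open>m > 0\<close> Cv0[OF iN] by simp
      have "m * (C *\<^sub>v v) $ i = 0" using sum0 s0 m0 by linarith
      then have z: "(C *\<^sub>v v) $ i = 0" using \<open>m > 0\<close> by simp
      have "(\<Sum>j = 0..<n. T $$ (i, j) * ((m - u j) * v $ j)) = 0" using sum0 s0 m0 by linarith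
      then have "\<forall>j\<in>{0..<n}. T $$ (i, j) * ((m - u j) * v $ j) = 0"
        by (subst sum_nonneg_eq_0_iff[symmetric]) (use nn in auto)
      then have "T $$ (i, j) * (m - u j) = 0" if "j < n" for j
        using that pos[OF that] by auto
      then show ?thesis using z by blast
    qed
    have "i0 \<in> zero_indices (C *\<^sub>v v)"
      using extremal[OF i0] i0 C by (auto simp: S_def zero_indices_def simp del: index_mult_mat_vec)
    then have "\<exists>j \<in> pos_indices (C *\<^sub>v v). j \<in> S"
    proof (rule connects_closed_set_meets_target[OF con _ i0 B])
      show "pos_indices (C *\<^sub>v v) \<subseteq> {..<n}" using C by (auto simp: pos_indices_def)
      fix j k assume j: "j \<in> S" and k: "k < n" and "B $$ (j, k) \<noteq> 0"
      show "k \<in> S"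
      proof (cases "j = k")
        case False
        then have "C $$ (j, k) \<noteq> 0" using sub \<open>B $$ (j, k) \<noteq> 0\<close> j k by (auto simp: S_def)
        then have "T $$ (j, k) \<noteq> 0" using False j k C by (auto simp: S_def T_def)
        then show ?thesis using extremal[OF j] k by (auto simp: S_def)
      qed (use j in simp)
    qed
    then show False using extremal by (auto simp: pos_indices_def simp del: index_mult_mat_vec)
  qed
  then have "spectral_radius ?T < s"
    using spectral_radius_mem_max(1)[OF cT n] by auto
  then show ?thesis
    unfolding nonsingular_M_matrix_def using T T0 CT
    by (intro exI[of _ n] exI[of _ s] exI[of _ T]) (auto simp: less_eq_mat_def)
qed

section \<open>Explicit inverses\<close>

lemma mat_inv_eqI:
  assumes A: "A \<in> carrier_mat n n" and B: "B \<in> carrier_mat n n" and AB: "A * B = 1\<^sub>m n"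
  shows "mat_inv A = B"
proof -
  have BA: "B * A = 1\<^sub>m n" by (rule mat_mult_left_right_inverse[OF A B AB])
  have "A \<in> Units (ring_mat TYPE(real) n ())"
    using A B AB BA by (auto simp: Units_def ring_mat_def)
  then obtain B' where B': "mat_inverse A = Some B'"
    using mat_inverse(1)[OF A, of "()"] by (cases "mat_inverse A") auto
  then have "A * B' = 1\<^sub>m n" "B' \<in> carrier_mat n n" using mat_inverse(2)[OF A B'] by auto
  then have "B' = B" using assoc_mult_mat[OF B A, of B' n] BA B by simp
  then show ?thesis using B' by (simp add: mat_inv_def)
qed

lemma inverse_of_diagonal:
  fixes D :: "real mat"
  assumes D: "D \<in> carrier_mat n n" "diagonal_mat D" and pos: "\<And>i. i < n \<Longrightarrow> D $$ (i, i) > 0"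
  shows "mat_inv D \<in> carrier_mat n n" "D * mat_inv D = 1\<^sub>m n"
    "\<And>i j. i < n \<Longrightarrow> j < n \<Longrightarrow> mat_inv D $$ (i, j) = (if i = j then 1 / D $$ (i, i) else 0)"
proof -
  define E where "E = Matrix.mat n n (\<lambda>(i, j). if i = j then 1 / D $$ (i, i) else 0)"
  have E: "E \<in> carrier_mat n n" by (simp add: E_def)
  have DE: "D * E = 1\<^sub>m n"
  proof (rule eq_matI)
    fix i j assume "i < dim_row (1\<^sub>m n :: real mat)" "j < dim_col (1\<^sub>m n :: real mat)"
    then have ij: "i < n" "j < n" by auto
    have "(D * E) $$ (i, j) = (\<Sum>l = 0..<n. if l = j then D $$ (i, j) / D $$ (j, j) else 0)"
      unfolding mult_mat_index_sum[OF D(1) E ij] using ij by (intro sum.cong) (auto simp: E_def)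
    also have "\<dots> = D $$ (i, j) / D $$ (j, j)" using ij by simp
    also have "\<dots> = 1\<^sub>m n $$ (i, j)"
      using ij D pos[OF ij(2)] by (auto simp: diagonal_mat_def)
    finally show "(D * E) $$ (i, j) = 1\<^sub>m n $$ (i, j)" .
  qed (use D E in auto)
  have inv: "mat_inv D = E" by (rule mat_inv_eqI[OF D(1) E DE])
  show "mat_inv D \<in> carrier_mat n n" "D * mat_inv D = 1\<^sub>m n" using inv E DE by auto
  show "mat_inv D $$ (i, j) = (if i = j then 1 / D $$ (i, i) else 0)" if "i < n" "j < n" for i j
    using inv that by (simp add: E_def)
qed

section \<open>The factorization\<close>

theorem theorem3p6:
  fixes n :: nat and A Az As Ads :: "real mat" and e :: "real Matrix.vec"
  assumes A: "A \<in> carrier_mat n n"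
    and Az: "Az \<in> carrier_mat n n" "Az \<le> 0\<^sub>m n n"
    and As: "As \<in> carrier_mat n n" "As \<le> 0\<^sub>m n n"
    and decomp: "offdiag_neg_part A = Az + As"
    and Ads: "Ads \<in> carrier_mat n n" "diagonal_mat Ads" "diag_part A \<le> Ads"
    and a: "nonsingular_M_matrix (Ads + Az)"
    and b: "offdiag_pos_part A \<le> Az * mat_inv Ads * As"
    and c: "e \<in> carrier_vec n" "e \<noteq> 0\<^sub>v n" "0\<^sub>v n \<le> e" "0\<^sub>v n \<le> A *\<^sub>v e"
      "connects Az (zero_indices (A *\<^sub>v e)) (pos_indices (A *\<^sub>v e)) \<or>
       connects As (zero_indices (A *\<^sub>v e)) (pos_indices (A *\<^sub>v e))"
  shows "(\<exists>M\<^sub>1 \<in> carrier_mat n n. \<exists>M\<^sub>2 \<in> carrier_mat n n.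
            nonsingular_M_matrix M\<^sub>1 \<and> nonsingular_M_matrix M\<^sub>2 \<and> A = M\<^sub>1 * M\<^sub>2)
       \<and> invertible_mat A \<and> 0\<^sub>m n n \<le> mat_inv A"
proof -
  have n: "n > 0"
  proof (rule ccontr)
    assume "\<not> n > 0"
    then have "e = 0\<^sub>v n" using c(1) by (intro eq_vecI) auto
    then show False using c(2) by simp
  qed
  define M where "M = Ads + Az"
  have M: "nonsingular_M_matrix M" "M \<in> carrier_mat n n" using a Ads Az by (auto simp: M_def)
  have Az0: "Az $$ (i, j) \<le> 0" and As0: "As $$ (i, j) \<le> 0" if "i < n" "j < n" for i j
    using Az As that by (auto simp: less_eq_mat_def)
  have split: "(offdiag_neg_part A) $$ (i, j) = Az $$ (i, j) + As $$ (i, j)"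
    if "i < n" "j < n" for i j
    using decomp Az As that by simp
  have parts: "A $$ (i, j) = diag_part A $$ (i, j) + offdiag_pos_part A $$ (i, j)
      + offdiag_neg_part A $$ (i, j)" if "i < n" "j < n" for i j
    using A that by (auto simp: diag_part_def offdiag_part_def offdiag_pos_part_def offdiag_neg_part_def)
  \<comment> \<open>The nonpositive matrices \<open>A\<^sup>z\<close> and \<open>A\<^sup>s\<close> add up to a matrix with zero diagonal. So \<open>M\<close> has the
     diagonal of \<open>A\<^sub>d\<^sub>*\<close>, which is therefore positive.\<close>
  have diag0: "Az $$ (i, i) = 0" if i: "i < n" for i
  proof -
    have "Az $$ (i, i) + As $$ (i, i) = 0"
      using split[OF i i] A i
      by (auto simp: diag_part_def offdiag_part_def offdiag_pos_part_def offdiag_neg_part_def)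
    then show ?thesis using Az0[OF i i] As0[OF i i] by linarith
  qed
  have d: "Ads $$ (i, i) > 0" if i: "i < n" for i
    using nonsingular_M_matrix_diag_pos[OF M i] diag0[OF i] i Ads Az by (simp add: M_def)
  define E where "E = mat_inv Ads"
  have E: "E \<in> carrier_mat n n" "Ads * E = 1\<^sub>m n"
    "\<And>i j. i < n \<Longrightarrow> j < n \<Longrightarrow> E $$ (i, j) = (if i = j then 1 / Ads $$ (i, i) else 0)"
    unfolding E_def by (intro inverse_of_diagonal[OF Ads(1,2)] d; assumption)+
  define N where "N = 1\<^sub>m n + E * As"
  have EAs: "E * As \<in> carrier_mat n n" and N: "N \<in> carrier_mat n n"
    using E(1) As by (auto simp: N_def)
  have N_offdiag: "N $$ (i, j) = As $$ (i, j) / Ads $$ (i, i)"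
    if ij: "i < n" "j < n" "i \<noteq> j" for i j
  proof -
    have "(E * As) $$ (i, j) = (\<Sum>l = 0..<n. if l = i then As $$ (i, j) / Ads $$ (i, i) else 0)"
      unfolding mult_mat_index_sum[OF E(1) As(1) ij(1,2)]
      using E(3) ij by (intro sum.cong) auto
    also have "\<dots> = As $$ (i, j) / Ads $$ (i, i)" using ij by simp
    finally show ?thesis using ij E(1) As(1) by (simp add: N_def del: index_mult_mat(1))
  qed
  have MN: "M * N = Ads + Az + As + Az * E * As"
  proof -
    have "M * N = M * 1\<^sub>m n + M * (E * As)"
      unfolding N_def using M EAs by (intro mult_add_distrib_mat) auto
    also have "M * (E * As) = Ads * (E * As) + Az * (E * As)"
      unfolding M_def using Ads Az EAs by (intro add_mult_distrib_mat) auto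
    also have "Ads * (E * As) = As"
      using assoc_mult_mat[OF Ads(1) E(1) As(1)] E(2) As by simp
    also have "Az * (E * As) = Az * E * As"
      using assoc_mult_mat[OF Az(1) E(1) As(1)] by simp
    also have "M * 1\<^sub>m n + (As + Az * E * As) = Ads + Az + As + Az * E * As"
      using M Ads Az As E(1) unfolding M_def
      by (subst assoc_add_mat[of _ n n]) auto
    finally show ?thesis .
  qed
  \<comment> \<open>Entrywise comparison of \<open>A = A\<^sub>d + A\<^sub>a\<^sup>+ + A\<^sup>z + A\<^sup>s\<close> with the four summands of \<open>M N\<close>.\<close>
  have A_le: "0\<^sub>m n n \<le> M * N - A"
  proof -
    have "A $$ (i, j) \<le> (M * N) $$ (i, j)" if ij: "i < n" "j < n" for i j
    proof -
      have "diag_part A $$ (i, j) \<le> Ads $$ (i, j)"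
        using Ads ij by (auto simp: less_eq_mat_def)
      moreover have "offdiag_pos_part A $$ (i, j) \<le> (Az * E * As) $$ (i, j)"
        using b ij Az As E(1) unfolding E_def less_eq_mat_def by simp
      moreover have "(M * N) $$ (i, j) = Ads $$ (i, j) + Az $$ (i, j) + As $$ (i, j)
          + (Az * E * As) $$ (i, j)"
        unfolding MN using ij Az As Ads E(1) by simp
      ultimately show ?thesis using parts[OF ij] split[OF ij] by linarith
    qed
    then show ?thesis using A M N by (auto simp: less_eq_mat_def)
  qed
  obtain P where P: "P \<in> carrier_mat n n" "0\<^sub>m n n \<le> P" "M * P = 1\<^sub>m n" "P * M = 1\<^sub>m n"
    using nonsingular_M_matrix_nonneg_inverse[OF M] .
  define C where "C = P * A"
  have C: "C \<in> carrier_mat n n" using P A by (simp add: C_def)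
  have AMC: "A = M * C"
    using assoc_mult_mat[OF M(2) P(1) A] P(3) A by (simp add: C_def)
  \<comment> \<open>\<open>N - C = M\<^sup>-\<^sup>1 (M N - A)\<close> is a product of nonnegative matrices.\<close>
  have C_le_N: "C $$ (i, j) \<le> N $$ (i, j)" if ij: "i < n" "j < n" for i j
  proof -
    have "0\<^sub>m n n \<le> P * (M * N - A)"
      using A_le P M N A by (intro mult_mat_nonneg) auto
    also have "P * (M * N - A) = P * (M * N) - P * A"
      using P M N A by (intro mult_minus_distrib_mat) auto
    also have "P * (M * N) = N"
      using assoc_mult_mat[OF P(1) M(2) N] P(4) N by simp
    finally show ?thesis using ij N C unfolding C_def[symmetric] by (auto simp: less_eq_mat_def)
  qed
  have C_le: "C $$ (i, j) \<le> As $$ (i, j) / Ads $$ (i, i)" if "i < n" "j < n" "i \<noteq> j" for i j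
    using C_le_N N_offdiag that by metis
  have ZC: "C $$ (i, j) \<le> 0" if "i < n" "j < n" "i \<noteq> j" for i j
    using C_le[OF that] As0[OF that(1,2)] d[OF that(1)]
    by (meson divide_nonpos_pos order_trans)
  have ZM: "M $$ (i, j) \<le> 0" if "i < n" "j < n" "i \<noteq> j" for i j
    using nonsingular_M_matrix_offdiag_nonpos[OF M that] .
  define w where "w = A *\<^sub>v e"
  define y where "y = C *\<^sub>v e"
  have w: "w \<in> carrier_vec n" "0\<^sub>v n \<le> w" using A c by (auto simp: w_def)
  have y: "y \<in> carrier_vec n" using C c(1) by (simp add: y_def)
  have "y = P *\<^sub>v w" using assoc_mult_mat_vec[OF P(1) A c(1)] by (simp add: y_def C_def w_def)
  then have y0: "0\<^sub>v n \<le> y" using mult_mat_vec_nonneg[OF P(1) w(1) P(2) w(2)] by simp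
  have My: "M *\<^sub>v y = w" using assoc_mult_mat_vec[OF M(2) C c(1)] by (simp add: y_def w_def AMC)
  \<comment> \<open>Only the diagonal term of \<open>(M y)\<^sub>i = w\<^sub>i\<close> can be positive, so \<open>y\<close> is positive wherever \<open>w\<close> is.\<close>
  have wy: "w $ i \<le> M $$ (i, i) * y $ i" if i: "i < n" for i
  proof -
    have "w $ i = M $$ (i, i) * y $ i + (\<Sum>l \<in> {0..<n} - {i}. M $$ (i, l) * y $ l)"
      using mult_mat_vec_index_sum[OF M(2) y i] i
      unfolding My by (simp add: sum.remove[of _ i])
    also have "(\<Sum>l \<in> {0..<n} - {i}. M $$ (i, l) * y $ l) \<le> 0"
      using i ZM y0 by (intro sum_nonpos) (auto simp: mult_nonpos_nonneg less_eq_vec_def)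
    finally show ?thesis by simp
  qed
  have pos_sub: "pos_indices w \<subseteq> pos_indices y"
  proof
    fix i assume "i \<in> pos_indices w"
    then have i: "i < n" "w $ i > 0" using w by (auto simp: pos_indices_def)
    then have "M $$ (i, i) * y $ i > 0" using wy[OF i(1)] by linarith
    then have "y $ i > 0" using nonsingular_M_matrix_diag_pos[OF M i(1)]
      by (simp add: zero_less_mult_iff)
    then show "i \<in> pos_indices y" using i y by (auto simp: pos_indices_def)
  qed
  have zero_sub: "zero_indices y \<subseteq> zero_indices w"
  proof
    fix i assume "i \<in> zero_indices y"
    then have i: "i < n" "y $ i = 0" using y by (auto simp: zero_indices_def)
    have "w $ i \<ge> 0" using w i by (auto simp: less_eq_vec_def)
    then show "i \<in> zero_indices w" using wy[OF i(1)] i w by (auto simp: zero_indices_def)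
  qed
  \<comment> \<open>If \<open>A\<^sup>s\<close> already connects, the sources have only shrunk and the targets grown in passing from
     \<open>w = A e\<close> to \<open>y = C e\<close>. If \<open>A\<^sup>z\<close> connects, no source is left, and the claim is vacuous.\<close>
  have "connects As (zero_indices y) (pos_indices y)"
  proof (cases "connects As (zero_indices w) (pos_indices w)")
    case True
    then show ?thesis using pos_sub zero_sub unfolding connects_def by (meson subsetD)
  next
    case False
    then have con: "connects Az (zero_indices (M *\<^sub>v y)) (pos_indices (M *\<^sub>v y))"
      using c(5) unfolding My w_def by simp
    have "y $ i > 0" if "i < n" for i
    proof (rule positive_of_connects[OF M(2) Az(1) ZM _ y y0 _ con that])
      show "0\<^sub>v n \<le> M *\<^sub>v y" using My w by simp
      show "M $$ (i, j) \<noteq> 0" if "i < n" "j < n" "i \<noteq> j" "Az $$ (i, j) \<noteq> 0" for i j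
        using that Ads Az by (auto simp: M_def diagonal_mat_def)
    qed
    then have "zero_indices y = {}" using y by (force simp: zero_indices_def)
    then show ?thesis by (simp add: connects_def)
  qed
  then have MC: "nonsingular_M_matrix C"
  proof (intro nonsingular_M_matrix_of_connects[OF C As(1) ZC _ c(1,3) _ _ n])
    show "C $$ (i, j) \<noteq> 0" if "i < n" "j < n" "i \<noteq> j" "As $$ (i, j) \<noteq> 0" for i j
    proof -
      have "As $$ (i, j) / Ads $$ (i, i) < 0"
        using As0[OF that(1,2)] that d by (simp add: divide_neg_pos)
      then show ?thesis using C_le[OF that(1-3)] by linarith
    qed
  qed (use y0 in \<open>auto simp: y_def\<close>)
  obtain Q where Q: "Q \<in> carrier_mat n n" "0\<^sub>m n n \<le> Q" "C * Q = 1\<^sub>m n" "Q * C = 1\<^sub>m n"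
    using nonsingular_M_matrix_nonneg_inverse[OF MC C] .
  have QP: "Q * P \<in> carrier_mat n n" using Q P by simp
  have AQP: "A * (Q * P) = 1\<^sub>m n"
  proof -
    have "A * (Q * P) = M * (C * (Q * P))"
      unfolding AMC by (rule assoc_mult_mat[OF M(2) C QP])
    also have "C * (Q * P) = P" using assoc_mult_mat[OF C Q(1) P(1)] Q(3) P(1) by simp
    finally show ?thesis using P(3) by simp
  qed
  have "invertible_mat A"
    using A QP AQP mat_mult_left_right_inverse[OF A QP AQP]
    unfolding invertible_mat_def inverts_mat_def by auto
  moreover have "0\<^sub>m n n \<le> mat_inv A"
    unfolding mat_inv_eqI[OF A QP AQP] using Q P by (intro mult_mat_nonneg) auto
  ultimately show ?thesis using M MC C AMC by blast
qed

end
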